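(* Let $\alpha>0$, $\beta,\rho,\eta,\kappa\in\mathbb{R}$, let $x>0$, let $p,q>1$ satisfy $\frac1p+\frac1q=1$, and let $f,g\in X_c^p(0,x)$ (with $c\in\mathbb{R}$) be two positive functions on $[0,\infty)$. Let $$m=\min_{0\le t\le x}\frac{f(t)}{g(t)}\qquad\text{and}\qquad M=\max_{0\le t\le x}\frac{f(t)}{g(t)}.$$ Write $I\varphi={}^{\rho}\mathcal{I}_{\eta,\kappa}^{\alpha,\beta}\varphi(x)$. Then the following inequalities hold: 1. $\displaystyle 0\le I(f^2)\,I(g^2)\le\frac{(M+m)^2}{4Mm}\bigl(I(fg)\bigr)^2.$ 2. $\displaystyle 0\le\sqrt{I(f^2)\,I(g^2)}-I(fg)\le\frac{(\sqrt M-\sqrt m)^2}{2\sqrt{Mm}}\,I(fg).$ 3. $\displaystyle 0\le I(f^2)\,I(g^2)-\bigl(I(fg)\bigr)^2\le\frac{(M-m)^2}{4Mm}\bigl(I(fg)\bigr)^2.$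
   Context: For a function $\varphi$ on $[0,\infty)$, the (left-sided, based at $0$) Katugampola fractional integral is $${}^{\rho}\mathcal{I}_{\eta,\kappa}^{\alpha,\beta}\varphi(x)=\frac{\rho^{1-\beta}x^{\kappa}}{\Gamma(\alpha)}\int_{0}^{x}\frac{\tau^{\rho(\eta+1)-1}}{(x^{\rho}-\tau^{\rho})^{1-\alpha}}\varphi(\tau)\,d\tau,\qquad x>0,$$ defined if the integral exists. For $c\in\mathbb{R}$ and $1\le p<\infty$, $X_c^p(a,b)$ is the space of complex-valued Lebesgue measurable functions $\varphi$ on $(a,b)$ with $\|\varphi\|_{X_c^p}=\left(\int_a^b|t^c\varphi(t)|^p\frac{dt}{t}\right)^{1/p}<\infty$. Powers and products of functions are pointwise, and $\Gamma$ is the Gamma function.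
   Formalization: For ρ ≤ 0 the real powers in the operator are generally undefined, and inequality 2 can fail (e.g. ρ=−1, α=1, β=0, η=−2, f=g=1); the formal version reads powers of negative numbers as positive, so the operator is the stated one for ρ>0. *)

theory Defs
  imports "HOL-Analysis.Analysis"
begin

text \<open>
  For \<open>\<rho> > 0\<close> every base below is positive on \<open>0 < \<tau> < x\<close>, so \<open>powr\<close> is the usual real
  power. For \<open>\<rho> \<le> 0\<close> the real powers in the formula are in general undefined, and the values
  here are those given by the conventions of \<open>powr\<close> for nonpositive bases. The Bochner integral
  is \<open>0\<close> when the integrand is not Lebesgue integrable, so the operator is total.
\<close>

definition katugampola_integral ::
    "real \<Rightarrow> real \<Rightarrow> real \<Rightarrow> real \<Rightarrow> real \<Rightarrow> (real \<Rightarrow> real) \<Rightarrow> real \<Rightarrow> real" where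
  "katugampola_integral \<rho> \<alpha> \<beta> \<eta> \<kappa> \<phi> x =
     \<rho> powr (1 - \<beta>) * x powr \<kappa> / Gamma \<alpha> *
       (LINT \<tau>:{0<..<x}|lebesgue.
          \<tau> powr (\<rho> * (\<eta> + 1) - 1) / (x powr \<rho> - \<tau> powr \<rho>) powr (1 - \<alpha>) * \<phi> \<tau>)"

text \<open>
  Meant for \<open>0 \<le> a\<close> and \<open>1 \<le> p\<close>. The norm takes values in \<open>[0, \<infinity>]\<close>; there is no \<open>powr\<close> on
  \<open>ennreal\<close>, hence the case distinction for the \<open>p\<close>-th root.
\<close>

definition Xcp_norm :: "real \<Rightarrow> real \<Rightarrow> real \<Rightarrow> real \<Rightarrow> (real \<Rightarrow> complex) \<Rightarrow> ennreal" where
  "Xcp_norm c p a b \<phi> =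
     (let N = \<integral>\<^sup>+ t \<in> {a<..<b}. ennreal (norm (complex_of_real (t powr c) * \<phi> t) powr p / t) \<partial>lebesgue
      in if N = \<infinity> then \<infinity> else ennreal (enn2real N powr (1 / p)))"

definition Xcp_space :: "real \<Rightarrow> real \<Rightarrow> real \<Rightarrow> real \<Rightarrow> (real \<Rightarrow> complex) set" where
  "Xcp_space c p a b =
     {\<phi>. \<phi> \<in> borel_measurable (lebesgue_on {a<..<b}) \<and> Xcp_norm c p a b \<phi> < \<infinity>}"

end

theory Submission
  imports Defs
begin

text \<open>
  The kernel of the operator is nonnegative, so everything reduces to weighted integrals. Integrating
  \<open>(f - m g) (M g - f) \<ge> 0\<close> gives the Diaz-Metcalf inequality
  \<open>I(f\<^sup>2) + M m I(g\<^sup>2) \<le> (M + m) I(f g)\<close>; the arithmetic-geometric mean inequality on its left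
  side and the Cauchy-Schwarz inequality yield all three claims. The ratio bounds make
  \<open>f\<^sup>2\<close>, \<open>f g\<close> and \<open>g\<^sup>2\<close> comparable, so either all three integrals exist or all three take the
  default value \<open>0\<close>, and the inequalities hold in the latter case too.
\<close>

text \<open>Pure algebra, with \<open>A\<close>, \<open>B\<close>, \<open>D\<close> standing for the
  values of the operator at f^2, g^2 and fg; analysis has to supply \<open>cs\<close> and
  \<open>dm\<close>. The other two upper bounds follow from the first, one by subtracting
  \<open>D\<^sup>2\<close>, the other by taking roots and then subtracting \<open>D\<close>.\<close>

lemma reverse_cauchy_schwarz_bounds:
  fixes A B D m M :: real
  assumes "0 \<le> A" "0 \<le> B" "0 \<le> D" and m: "0 < m" and M: "m \<le> M"
    and cs: "D\<^sup>2 \<le> A * B"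
    and dm: "A + M * m * B \<le> (M + m) * D"
  shows "A * B \<le> (M + m)\<^sup>2 / (4 * M * m) * D\<^sup>2"
    and "D \<le> sqrt (A * B)"
    and "sqrt (A * B) - D \<le> (sqrt M - sqrt m)\<^sup>2 / (2 * sqrt (M * m)) * D"
    and "A * B - D\<^sup>2 \<le> (M - m)\<^sup>2 / (4 * M * m) * D\<^sup>2"
proof -
  have Mm: "0 < M * m" using m M by simp
  have "4 * (M * m) * (A * B) \<le> (A + M * m * B)\<^sup>2"
    using zero_le_power2[of "A - M * m * B"] by (simp add: power2_eq_square algebra_simps)
  also have "\<dots> \<le> ((M + m) * D)\<^sup>2"
    using dm assms(1,2) Mm by (intro power_mono) auto
  finally have *: "4 * (M * m) * (A * B) \<le> (M + m)\<^sup>2 * D\<^sup>2"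
    by (simp add: power_mult_distrib)
  show 1: "A * B \<le> (M + m)\<^sup>2 / (4 * M * m) * D\<^sup>2"
    using * Mm by (simp add: field_simps)
  show "D \<le> sqrt (A * B)"
    using cs by (rule real_le_rsqrt)
  have "A * B - D\<^sup>2 \<le> ((M + m)\<^sup>2 / (4 * M * m) - 1) * D\<^sup>2"
    using 1 by (simp add: algebra_simps)
  also have "(M + m)\<^sup>2 / (4 * M * m) - 1 = (M - m)\<^sup>2 / (4 * M * m)"
    using m M by (simp add: field_simps power2_eq_square)
  finally show "A * B - D\<^sup>2 \<le> (M - m)\<^sup>2 / (4 * M * m) * D\<^sup>2" .
  \<comment> \<open>Since \<open>0 \<le> D\<close>, the root on the right is
    \<open>(M + m) * D\<close> itself.\<close>
  have "sqrt (4 * (M * m) * (A * B)) \<le> sqrt (((M + m) * D)\<^sup>2)"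
    using * by (simp add: power_mult_distrib)
  then have "2 * sqrt (M * m) * sqrt (A * B) \<le> (M + m) * D"
    using assms(3) m M by (simp add: real_sqrt_mult)
  then have "sqrt (A * B) \<le> (M + m) / (2 * sqrt (M * m)) * D"
    using Mm by (simp add: pos_le_divide_eq mult.commute)
  moreover have "(sqrt M - sqrt m)\<^sup>2 / (2 * sqrt (M * m)) = (M + m) / (2 * sqrt (M * m)) - 1"
  proof -
    have "(sqrt M - sqrt m)\<^sup>2 = M + m - 2 * sqrt (M * m)"
      using m M by (simp add: power2_diff real_sqrt_mult)
    then show ?thesis
      using m M by (simp add: diff_divide_distrib)
  qed
  ultimately show "sqrt (A * B) - D \<le> (sqrt M - sqrt m)\<^sup>2 / (2 * sqrt (M * m)) * D"
    by (simp add: left_diff_distrib)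
qed

context
  fixes N :: "'a measure" and w f g :: "'a \<Rightarrow> real" and m M :: real
  assumes meas [measurable]: "w \<in> borel_measurable N" "f \<in> borel_measurable N" "g \<in> borel_measurable N"
    and w: "\<And>t. t \<in> space N \<Longrightarrow> 0 \<le> w t"
    and f: "\<And>t. t \<in> space N \<Longrightarrow> 0 < f t"
    and g: "\<And>t. t \<in> space N \<Longrightarrow> 0 < g t"
    and m: "0 < m"
    and lower: "\<And>t. t \<in> space N \<Longrightarrow> m * g t \<le> f t"
    and upper: "\<And>t. t \<in> space N \<Longrightarrow> f t \<le> M * g t"
begin

text \<open>Rules out the mixed case in which one integral takes the default value 0 while another
  is genuine; there the later inequalities could fail.\<close>

lemma weighted_squares_integrable_iff:
  shows "integrable N (\<lambda>t. w t * (f t)\<^sup>2) \<longleftrightarrow> integrable N (\<lambda>t. w t * (f t * g t))"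
    and "integrable N (\<lambda>t. w t * (g t)\<^sup>2) \<longleftrightarrow> integrable N (\<lambda>t. w t * (f t * g t))"
proof -
  \<comment> \<open>Since \<open>w\<close> and \<open>v\<close> are nonnegative,
    \<open>w t * v t\<close> is its own norm, so the pointwise bound by \<open>C * u t\<close> is a
    domination.\<close>
  have dominated: "integrable N (\<lambda>t. w t * v t)"
    if "integrable N (\<lambda>t. w t * u t)" and [measurable]: "v \<in> borel_measurable N"
      and "\<And>t. t \<in> space N \<Longrightarrow> 0 \<le> v t" "\<And>t. t \<in> space N \<Longrightarrow> v t \<le> C * u t" for u v C
  proof (rule Bochner_Integration.integrable_bound)
    show "integrable N (\<lambda>t. C * (w t * u t))"
      using that(1) by simp
    show "AE t in N. norm (w t * v t) \<le> norm (C * (w t * u t))"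
    proof (rule AE_I2)
      fix t assume t: "t \<in> space N"
      have "w t * v t \<le> w t * (C * u t)"
        using w[OF t] that(4)[OF t] by (rule mult_left_mono[rotated])
      then show "norm (w t * v t) \<le> norm (C * (w t * u t))"
        using w[OF t] that(3)[OF t] by (simp add: mult.left_commute)
    qed
  qed measurable
  \<comment> \<open>Multiply \<open>m * g t \<le> f t \<le> M * g t\<close> by \<open>f t\<close>
    and by \<open>g t\<close>; positivity of \<open>m\<close> allows the division.\<close>
  have le: "(f t)\<^sup>2 \<le> M * (f t * g t)" "f t * g t \<le> (1 / m) * (f t)\<^sup>2"
    "(g t)\<^sup>2 \<le> (1 / m) * (f t * g t)" "f t * g t \<le> M * (g t)\<^sup>2" if t: "t \<in> space N" for t
    using mult_left_mono[OF upper[OF t], of "f t"] mult_left_mono[OF lower[OF t], of "f t"]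
      mult_left_mono[OF upper[OF t], of "g t"] mult_left_mono[OF lower[OF t], of "g t"]
      f[OF t] g[OF t] m
    by (simp_all add: power2_eq_square field_simps)
  have fg: "0 \<le> f t * g t" if "t \<in> space N" for t
    using f[OF that] g[OF that] by simp
  show "integrable N (\<lambda>t. w t * (f t)\<^sup>2) \<longleftrightarrow> integrable N (\<lambda>t. w t * (f t * g t))"
    using dominated[OF _ _ _ le(1)] dominated[OF _ _ fg le(2)] by auto
  show "integrable N (\<lambda>t. w t * (g t)\<^sup>2) \<longleftrightarrow> integrable N (\<lambda>t. w t * (f t * g t))"
    using dominated[OF _ _ _ le(3)] dominated[OF _ _ fg le(4)] by auto
qed

lemma integral_weighted_product_nonneg: "0 \<le> (\<integral>t. w t * (f t * g t) \<partial>N)"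
  using w f g by (intro Bochner_Integration.integral_nonneg) (simp add: less_imp_le)

lemma integral_weighted_square_nonneg:
  "0 \<le> (\<integral>t. w t * (f t)\<^sup>2 \<partial>N)" "0 \<le> (\<integral>t. w t * (g t)\<^sup>2 \<partial>N)"
  using w by (auto intro!: Bochner_Integration.integral_nonneg)

lemma Diaz_Metcalf_weighted:
  "(\<integral>t. w t * (f t)\<^sup>2 \<partial>N) + M * m * (\<integral>t. w t * (g t)\<^sup>2 \<partial>N) \<le> (M + m) * (\<integral>t. w t * (f t * g t) \<partial>N)"
proof (cases "integrable N (\<lambda>t. w t * (f t * g t))")
  case True
  note int = True weighted_squares_integrable_iff[THEN iffD2, OF True]
  have "0 \<le> (\<integral>t. w t * ((f t - m * g t) * (M * g t - f t)) \<partial>N)"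
    using w lower upper by (intro Bochner_Integration.integral_nonneg) simp
  also have "\<dots> = (\<integral>t. (M + m) * (w t * (f t * g t)) - w t * (f t)\<^sup>2 - M * m * (w t * (g t)\<^sup>2) \<partial>N)"
    by (simp add: algebra_simps power2_eq_square)
  also have "\<dots> = (M + m) * (\<integral>t. w t * (f t * g t) \<partial>N) - (\<integral>t. w t * (f t)\<^sup>2 \<partial>N)
      - M * m * (\<integral>t. w t * (g t)\<^sup>2 \<partial>N)"
    using int by simp
  finally show ?thesis by simp
next
  \<comment> \<open>Neither square is integrable either, so all three integrals are 0.\<close>
  case False
  then show ?thesis
    by (simp add: weighted_squares_integrable_iff not_integrable_integral_eq)
qed

text \<open>Discriminant argument: the integral of \<open>w t * (a * f t - b * g t)\<^sup>2\<close>
  is a nonnegative quadratic form in \<open>a\<close> and \<open>b\<close>.\<close>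

lemma Cauchy_Schwarz_weighted:
  "(\<integral>t. w t * (f t * g t) \<partial>N)\<^sup>2 \<le> (\<integral>t. w t * (f t)\<^sup>2 \<partial>N) * (\<integral>t. w t * (g t)\<^sup>2 \<partial>N)"
proof (cases "integrable N (\<lambda>t. w t * (f t * g t))")
  case True
  define A B D where "A = (\<integral>t. w t * (f t)\<^sup>2 \<partial>N)" and "B = (\<integral>t. w t * (g t)\<^sup>2 \<partial>N)"
    and "D = (\<integral>t. w t * (f t * g t) \<partial>N)"
  note int = True weighted_squares_integrable_iff[THEN iffD2, OF True]
  have quad: "0 \<le> a\<^sup>2 * A - 2 * a * b * D + b\<^sup>2 * B" for a b
  proof -
    have "0 \<le> (\<integral>t. w t * (a * f t - b * g t)\<^sup>2 \<partial>N)"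
      using w by (intro Bochner_Integration.integral_nonneg) simp
    also have "\<dots> = (\<integral>t. a\<^sup>2 * (w t * (f t)\<^sup>2) - 2 * a * b * (w t * (f t * g t)) + b\<^sup>2 * (w t * (g t)\<^sup>2) \<partial>N)"
      by (simp add: algebra_simps power2_eq_square)
    finally show ?thesis
      using int by (simp add: A_def B_def D_def)
  qed
  have "D\<^sup>2 \<le> A * B"
  proof (cases "B = 0")
    case True
    then show ?thesis
      \<comment> \<open>With \<open>B = 0\<close> this choice of \<open>b\<close> turns the form
        into \<open>- D\<^sup>2\<close>, which forces \<open>D = 0\<close>.\<close>
      using quad[of D "(A + 1) / 2"] by (simp add: power2_eq_square algebra_simps)
  next
    case False
    then have "0 < B"
      using integral_weighted_square_nonneg by (simp add: B_def order_less_le)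
    \<comment> \<open>At \<open>a = B\<close>, \<open>b = D\<close> the form factors as
      \<open>B * (A * B - D\<^sup>2)\<close>.\<close>
    moreover have "0 \<le> B * (A * B - D\<^sup>2)"
      using quad[of B D] by (simp add: power2_eq_square algebra_simps)
    ultimately show ?thesis
      by (simp add: zero_le_mult_iff)
  qed
  then show ?thesis
    by (simp add: A_def B_def D_def)
next
  case False
  then show ?thesis
    by (simp add: weighted_squares_integrable_iff not_integrable_integral_eq)
qed

end

text \<open>Moves the interval into the measure, so that the pointwise hypotheses of the weighted
  lemmas concern only 0 < t < x.\<close>

lemma katugampola_integral_eq_restrict_space:
  "katugampola_integral \<rho> \<alpha> \<beta> \<eta> \<kappa> \<phi> x =
    \<rho> powr (1 - \<beta>) * x powr \<kappa> / Gamma \<alpha> *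
      (\<integral>\<tau>. \<tau> powr (\<rho> * (\<eta> + 1) - 1) / (x powr \<rho> - \<tau> powr \<rho>) powr (1 - \<alpha>) * \<phi> \<tau>
        \<partial>lebesgue_on {0<..<x})"
  by (simp add: katugampola_integral_def set_lebesgue_integral_def integral_restrict_space)

theorem theorem5:
  fixes \<alpha> \<beta> \<rho> \<eta> \<kappa> x p q c m M :: real
    and f g :: "real \<Rightarrow> real"
    and I :: "(real \<Rightarrow> real) \<Rightarrow> real"
  assumes "\<alpha> > 0" and "x > 0"
    and "p > 1" and "q > 1" and "1 / p + 1 / q = 1"
    and "(\<lambda>t. complex_of_real (f t)) \<in> Xcp_space c p 0 x"
    and "(\<lambda>t. complex_of_real (g t)) \<in> Xcp_space c p 0 x"
    and "\<And>t. t \<ge> 0 \<Longrightarrow> f t > 0"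
    and "\<And>t. t \<ge> 0 \<Longrightarrow> g t > 0"
    and "\<exists>t\<in>{0..x}. f t / g t = m" and "\<And>t. t \<in> {0..x} \<Longrightarrow> m \<le> f t / g t"
    and "\<exists>t\<in>{0..x}. f t / g t = M" and "\<And>t. t \<in> {0..x} \<Longrightarrow> f t / g t \<le> M"
  defines "I \<equiv> \<lambda>\<phi>. katugampola_integral \<rho> \<alpha> \<beta> \<eta> \<kappa> \<phi> x"
  shows "(0 \<le> I (\<lambda>t. (f t)\<^sup>2) * I (\<lambda>t. (g t)\<^sup>2) \<and>
          I (\<lambda>t. (f t)\<^sup>2) * I (\<lambda>t. (g t)\<^sup>2) \<le> (M + m)\<^sup>2 / (4 * M * m) * (I (\<lambda>t. f t * g t))\<^sup>2) \<and>
         (0 \<le> sqrt (I (\<lambda>t. (f t)\<^sup>2) * I (\<lambda>t. (g t)\<^sup>2)) - I (\<lambda>t. f t * g t) \<and>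
          sqrt (I (\<lambda>t. (f t)\<^sup>2) * I (\<lambda>t. (g t)\<^sup>2)) - I (\<lambda>t. f t * g t)
            \<le> (sqrt M - sqrt m)\<^sup>2 / (2 * sqrt (M * m)) * I (\<lambda>t. f t * g t)) \<and>
         (0 \<le> I (\<lambda>t. (f t)\<^sup>2) * I (\<lambda>t. (g t)\<^sup>2) - (I (\<lambda>t. f t * g t))\<^sup>2 \<and>
          I (\<lambda>t. (f t)\<^sup>2) * I (\<lambda>t. (g t)\<^sup>2) - (I (\<lambda>t. f t * g t))\<^sup>2
            \<le> (M - m)\<^sup>2 / (4 * M * m) * (I (\<lambda>t. f t * g t))\<^sup>2)"
proof -
  let ?N = "lebesgue_on {0<..<x}"
  define w where "w = (\<lambda>\<tau>. \<tau> powr (\<rho> * (\<eta> + 1) - 1) / (x powr \<rho> - \<tau> powr \<rho>) powr (1 - \<alpha>))"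
  define K where "K = \<rho> powr (1 - \<beta>) * x powr \<kappa> / Gamma \<alpha>"
  have I: "I \<phi> = K * (\<integral>t. w t * \<phi> t \<partial>?N)" for \<phi>
    by (simp add: I_def katugampola_integral_eq_restrict_space K_def w_def)
  \<comment> \<open>\<open>powr\<close> is nonnegative for every real base, so this covers
    \<open>\<rho> \<le> 0\<close> as well.\<close>
  have K: "0 \<le> K"
    using assms(1) by (simp add: K_def Gamma_real_nonneg)
  have "w \<in> borel_measurable borel"
    unfolding w_def by measurable
  then have w_meas: "w \<in> borel_measurable ?N"
    by (intro measurable_restrict_space1 measurable_completion) simp
  \<comment> \<open>Membership in \<open>Xcp_space\<close> gives measurability of the complex-valued
    function; composing with \<open>Re\<close> recovers \<open>h\<close>.\<close>
  have Re_meas: "h \<in> borel_measurable ?N"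
    if "(\<lambda>t. complex_of_real (h t)) \<in> Xcp_space c p 0 x" for h
    using that measurable_compose[of "\<lambda>t. complex_of_real (h t)" ?N borel Re borel]
    by (simp add: Xcp_space_def)
  note meas = w_meas Re_meas[OF assms(6)] Re_meas[OF assms(7)]
  have w_nonneg: "0 \<le> w t" for t
    by (simp add: w_def)
  \<comment> \<open>The minimum is attained, hence it is a quotient of two positive values.\<close>
  have m: "0 < m"
    using assms(8-10) by fastforce
  have M: "m \<le> M"
    using assms(10,13) by blast
  have bounds: "0 < f t" "0 < g t" "m * g t \<le> f t" "f t \<le> M * g t" if "t \<in> space ?N" for t
    using that assms(8)[of t] assms(9)[of t] assms(11)[of t] assms(13)[of t] by (auto simp: field_simps)
  note weighted = meas w_nonneg bounds(1,2) m bounds(3,4)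
  let ?A = "I (\<lambda>t. (f t)\<^sup>2)" and ?B = "I (\<lambda>t. (g t)\<^sup>2)" and ?D = "I (\<lambda>t. f t * g t)"
  have nonneg: "0 \<le> ?A" "0 \<le> ?B" "0 \<le> ?D"
    using integral_weighted_square_nonneg[OF weighted] integral_weighted_product_nonneg[OF weighted] K
    by (simp_all add: I)
  \<comment> \<open>Both sides are quadratic in the prefactor \<open>K\<close>, hence the factor
    \<open>K\<^sup>2\<close>; the next inequality is linear in \<open>K\<close>.\<close>
  have cs: "?D\<^sup>2 \<le> ?A * ?B"
    using mult_left_mono[OF Cauchy_Schwarz_weighted[OF weighted], of "K\<^sup>2"]
    by (simp add: I power2_eq_square ac_simps)
  have dm: "?A + M * m * ?B \<le> (M + m) * ?D"
    using mult_left_mono[OF Diaz_Metcalf_weighted[OF weighted] K]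
    by (simp add: I algebra_simps)
  note reverse = reverse_cauchy_schwarz_bounds[OF nonneg m M cs dm]
  from nonneg(1,2) reverse cs show ?thesis
    by simp
qed

end
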